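(* For every finite set $\Gamma$ of MSO formulas and all core-wMSO$(?,+)$ formulas $\Phi_1,\Phi_2$: $\Phi_1\sim_\Gamma\Phi_2$ if and only if $\Gamma\vdash\Phi_1\approx\Phi_2$ in the core-wMSO$(?,+)$ proof system.
   Context: MSO over a finite alphabet $\Sigma$ (syntax $\top, P_a(x), x\le y, x\in X,\neg,\wedge,\forall x,\forall X$), interpreted over $(w,\sigma)$ with $w\in\Sigma^+$ and $\sigma$ a valuation (first-order variables to positions, second-order variables to sets of positions); $\Gamma\vdash\varphi$ refers to a fixed sound and complete proof system for MSO over finite nonempty words. step-wMSO over weights $R$: $\Psi::=r\mid\varphi\,?\,\Psi_1:\Psi_2$ ($[\![r]\!]=r$; conditional selects $\Psi_1$ if $\varphi$ holds, else $\Psi_2$). core-wMSO$(?,+)$: $\Phi::=\mathbf{0}\mid\prod_x\Psi\mid\varphi\,?\,\Phi_1:\Phi_2\mid\Phi_1+\Phi_2$, with semantics in finite multisets of words over $R$: $[\![\mathbf{0}]\!]=\emptyset$, $[\![\prod_x\Psi]\!](w,\sigma)$ the multiset with the single word $r_1\cdots r_{|w|}$, $r_i=[\![\Psi]\!](w,\sigma[x\mapsto i])$, conditional selecting by $\varphi$, $[\![\Phi_1+\Phi_2]\!]=[\![\Phi_1]\!]\uplus[\![\Phi_2]\!]$. $\chi_1\sim_\Gamma\chi_2$: equal semantics on all $(w,\sigma)$ satisfying all of $\Gamma$. The core-wMSO$(?,+)$ proof system derives $\Gamma\vdash\chi_1\approx\chi_2$ by: (ref), (sym), (trans); (cong?),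 (cong+) congruence for the conditional and $+$; (S1)/(C6) $\Gamma\vdash\chi_1\approx\chi_2\Rightarrow\Gamma\cup\{\varphi\}\vdash\chi_1\approx\chi_2$; (S2)/(C7) $\Gamma\vdash\neg\varphi\,?\,\chi_1:\chi_2\approx\varphi\,?\,\chi_2:\chi_1$; (S3)/(C8) $\Gamma\vdash\varphi\Rightarrow\Gamma\vdash\varphi\,?\,\chi_1:\chi_2\approx\chi_1$; (S4)/(C9) $\Gamma\cup\{\varphi\}\vdash\chi_1\approx\chi$ and $\Gamma\cup\{\neg\varphi\}\vdash\chi_2\approx\chi\Rightarrow\Gamma\vdash\varphi\,?\,\chi_1:\chi_2\approx\chi$ (S versions for step formulas, C versions for core formulas); (C1) $\Gamma\vdash\Phi+\mathbf{0}\approx\Phi$; (C2) $\Gamma\vdash\Phi_1+\Phi_2\approx\Phi_2+\Phi_1$; (C3) $\Gamma\vdash(\Phi_1+\Phi_2)+\Phi_3\approx\Phi_1+(\Phi_2+\Phi_3)$; (C4) $\Gamma\vdash\Psi_1\approx\Psi_2$ with $x$ not free in $\Gamma$ implies $\Gamma\vdash\prod_x\Psi_1\approx\prod_x\Psi_2$; (C5) $\Gamma\vdash\prod_x\Psi\approx\prod_y\Psi[y/x]$ if $y$ does not occur in $\Psi$; (C10) $\Gamma\vdash(\varphi\,?\,\Phi':\Phi'')+\Phi\approx\varphi\,?\,(\Phi'+\Phi):(\Phi''+\Phi)$. *)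

theory Defs
  imports "HOL-Library.Multiset"
begin

section \<open>MSO over finite nonempty words\<close>

text \<open>First-order and second-order variables are two separate countably infinite supplies, each
  named by natural numbers: the first-order variable \<open>n\<close> and the second-order variable \<open>n\<close> are
  unrelated.\<close>

type_synonym fovar = nat
type_synonym sovar = nat

datatype 'a mso =
    Top
  | Letter 'a fovar            (* P_a(x) *)
  | Leq fovar fovar            (* x \<le> y *)
  | Mem fovar sovar            (* x \<in> X *)
  | Neg "'a mso"
  | Conj "'a mso" "'a mso"
  | AllFO fovar "'a mso"
  | AllSO sovar "'a mso"

text \<open>Positions are numbered from 1, so the letter at position \<open>i\<close> is \<open>w ! (i - 1)\<close>.\<close>

definition positions :: "'a list \<Rightarrow> nat set" where
  "positions w = {1..length w}"

text \<open>A valuation is split into its first-order part \<open>\<sigma>\<close> and its second-order part \<open>\<tau>\<close>.\<close>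

definition valuation :: "'a list \<Rightarrow> (fovar \<Rightarrow> nat) \<Rightarrow> (sovar \<Rightarrow> nat set) \<Rightarrow> bool" where
  "valuation w \<sigma> \<tau> \<longleftrightarrow> (\<forall>x. \<sigma> x \<in> positions w) \<and> (\<forall>X. \<tau> X \<subseteq> positions w)"

primrec mso_sat :: "'a list \<Rightarrow> (fovar \<Rightarrow> nat) \<Rightarrow> (sovar \<Rightarrow> nat set) \<Rightarrow> 'a mso \<Rightarrow> bool" where
  "mso_sat w \<sigma> \<tau> Top \<longleftrightarrow> True"
| "mso_sat w \<sigma> \<tau> (Letter a x) \<longleftrightarrow> w ! (\<sigma> x - 1) = a"
| "mso_sat w \<sigma> \<tau> (Leq x y) \<longleftrightarrow> \<sigma> x \<le> \<sigma> y"
| "mso_sat w \<sigma> \<tau> (Mem x X) \<longleftrightarrow> \<sigma> x \<in> \<tau> X"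
| "mso_sat w \<sigma> \<tau> (Neg \<phi>) \<longleftrightarrow> \<not> mso_sat w \<sigma> \<tau> \<phi>"
| "mso_sat w \<sigma> \<tau> (Conj \<phi> \<psi>) \<longleftrightarrow> mso_sat w \<sigma> \<tau> \<phi> \<and> mso_sat w \<sigma> \<tau> \<psi>"
| "mso_sat w \<sigma> \<tau> (AllFO x \<phi>) \<longleftrightarrow> (\<forall>i\<in>positions w. mso_sat w (\<sigma>(x := i)) \<tau> \<phi>)"
| "mso_sat w \<sigma> \<tau> (AllSO X \<phi>) \<longleftrightarrow> (\<forall>I. I \<subseteq> positions w \<longrightarrow> mso_sat w \<sigma> (\<tau>(X := I)) \<phi>)"

definition models :: "'a list \<Rightarrow> (fovar \<Rightarrow> nat) \<Rightarrow> (sovar \<Rightarrow> nat set) \<Rightarrow> 'a mso set \<Rightarrow> bool" where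
  "models w \<sigma> \<tau> \<Gamma> \<longleftrightarrow> w \<noteq> [] \<and> valuation w \<sigma> \<tau> \<and> (\<forall>\<phi>\<in>\<Gamma>. mso_sat w \<sigma> \<tau> \<phi>)"

definition mso_entails :: "'a mso set \<Rightarrow> 'a mso \<Rightarrow> bool" where
  "mso_entails \<Gamma> \<phi> \<longleftrightarrow> (\<forall>w \<sigma> \<tau>. models w \<sigma> \<tau> \<Gamma> \<longrightarrow> mso_sat w \<sigma> \<tau> \<phi>)"

primrec mso_free :: "'a mso \<Rightarrow> fovar set" where
  "mso_free Top = {}"
| "mso_free (Letter a x) = {x}"
| "mso_free (Leq x y) = {x, y}"
| "mso_free (Mem x X) = {x}"
| "mso_free (Neg \<phi>) = mso_free \<phi>"
| "mso_free (Conj \<phi> \<psi>) = mso_free \<phi> \<union> mso_free \<psi>"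
| "mso_free (AllFO x \<phi>) = mso_free \<phi> - {x}"
| "mso_free (AllSO X \<phi>) = mso_free \<phi>"

text \<open>All occurring first-order variables, including bound ones and quantified variables that are
  not used in the body.\<close>

primrec mso_vars :: "'a mso \<Rightarrow> fovar set" where
  "mso_vars Top = {}"
| "mso_vars (Letter a x) = {x}"
| "mso_vars (Leq x y) = {x, y}"
| "mso_vars (Mem x X) = {x}"
| "mso_vars (Neg \<phi>) = mso_vars \<phi>"
| "mso_vars (Conj \<phi> \<psi>) = mso_vars \<phi> \<union> mso_vars \<psi>"
| "mso_vars (AllFO x \<phi>) = insert x (mso_vars \<phi>)"
| "mso_vars (AllSO X \<phi>) = mso_vars \<phi>"

text \<open>\<open>mso_subst y x \<phi>\<close> is \<open>\<phi>[y/x]\<close>: the free occurrences of \<open>x\<close> become \<open>y\<close>. Bound variables are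
  not renamed; the substitution is only used for a \<open>y\<close> that does not occur in \<open>\<phi>\<close>, where capture
  is impossible.\<close>

primrec mso_subst :: "fovar \<Rightarrow> fovar \<Rightarrow> 'a mso \<Rightarrow> 'a mso" where
  "mso_subst y x Top = Top"
| "mso_subst y x (Letter a z) = Letter a (if z = x then y else z)"
| "mso_subst y x (Leq z z') = Leq (if z = x then y else z) (if z' = x then y else z')"
| "mso_subst y x (Mem z X) = Mem (if z = x then y else z) X"
| "mso_subst y x (Neg \<phi>) = Neg (mso_subst y x \<phi>)"
| "mso_subst y x (Conj \<phi> \<psi>) = Conj (mso_subst y x \<phi>) (mso_subst y x \<psi>)"
| "mso_subst y x (AllFO z \<phi>) = AllFO z (if z = x then \<phi> else mso_subst y x \<phi>)"
| "mso_subst y x (AllSO X \<phi>) = AllSO X (mso_subst y x \<phi>)"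


section \<open>step-wMSO\<close>

datatype ('a, 'r) step =
    Weight 'r
  | StepIf "'a mso" "('a, 'r) step" "('a, 'r) step"

primrec step_sem ::
  "'a list \<Rightarrow> (fovar \<Rightarrow> nat) \<Rightarrow> (sovar \<Rightarrow> nat set) \<Rightarrow> ('a, 'r) step \<Rightarrow> 'r" where
  "step_sem w \<sigma> \<tau> (Weight r) = r"
| "step_sem w \<sigma> \<tau> (StepIf \<phi> \<Psi>1 \<Psi>2) =
     (if mso_sat w \<sigma> \<tau> \<phi> then step_sem w \<sigma> \<tau> \<Psi>1 else step_sem w \<sigma> \<tau> \<Psi>2)"

primrec step_vars :: "('a, 'r) step \<Rightarrow> fovar set" where
  "step_vars (Weight r) = {}"
| "step_vars (StepIf \<phi> \<Psi>1 \<Psi>2) = mso_vars \<phi> \<union> step_vars \<Psi>1 \<union> step_vars \<Psi>2"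

primrec step_subst :: "fovar \<Rightarrow> fovar \<Rightarrow> ('a, 'r) step \<Rightarrow> ('a, 'r) step" where
  "step_subst y x (Weight r) = Weight r"
| "step_subst y x (StepIf \<phi> \<Psi>1 \<Psi>2) =
     StepIf (mso_subst y x \<phi>) (step_subst y x \<Psi>1) (step_subst y x \<Psi>2)"

text \<open>The parameter \<open>prov\<close> is the MSO proof system: \<open>prov \<Gamma> \<phi>\<close> stands for \<open>\<Gamma> \<turnstile> \<phi>\<close>.\<close>

inductive step_prov ::
  "('a mso set \<Rightarrow> 'a mso \<Rightarrow> bool) \<Rightarrow> 'a mso set \<Rightarrow> ('a, 'r) step \<Rightarrow> ('a, 'r) step \<Rightarrow> bool"
  for prov :: "'a mso set \<Rightarrow> 'a mso \<Rightarrow> bool" where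
  S_ref: "step_prov prov \<Gamma> \<Psi> \<Psi>"
| S_sym: "step_prov prov \<Gamma> \<Psi>1 \<Psi>2 \<Longrightarrow> step_prov prov \<Gamma> \<Psi>2 \<Psi>1"
| S_trans: "step_prov prov \<Gamma> \<Psi>1 \<Psi>2 \<Longrightarrow> step_prov prov \<Gamma> \<Psi>2 \<Psi>3 \<Longrightarrow> step_prov prov \<Gamma> \<Psi>1 \<Psi>3"
| S_cong_if: "step_prov prov \<Gamma> \<Psi>1 \<Psi>1' \<Longrightarrow> step_prov prov \<Gamma> \<Psi>2 \<Psi>2' \<Longrightarrow>
    step_prov prov \<Gamma> (StepIf \<phi> \<Psi>1 \<Psi>2) (StepIf \<phi> \<Psi>1' \<Psi>2')"
| S1: "step_prov prov \<Gamma> \<Psi>1 \<Psi>2 \<Longrightarrow> step_prov prov (\<Gamma> \<union> {\<phi>}) \<Psi>1 \<Psi>2"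
| S2: "step_prov prov \<Gamma> (StepIf (Neg \<phi>) \<Psi>1 \<Psi>2) (StepIf \<phi> \<Psi>2 \<Psi>1)"
| S3: "prov \<Gamma> \<phi> \<Longrightarrow> step_prov prov \<Gamma> (StepIf \<phi> \<Psi>1 \<Psi>2) \<Psi>1"
| S4: "step_prov prov (\<Gamma> \<union> {\<phi>}) \<Psi>1 \<Psi> \<Longrightarrow> step_prov prov (\<Gamma> \<union> {Neg \<phi>}) \<Psi>2 \<Psi> \<Longrightarrow>
    step_prov prov \<Gamma> (StepIf \<phi> \<Psi>1 \<Psi>2) \<Psi>"


section \<open>core-wMSO with conditional and sum\<close>

datatype ('a, 'r) core =
    Zero
  | ProdFO fovar "('a, 'r) step"
  | CoreIf "'a mso" "('a, 'r) core" "('a, 'r) core"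
  | CorePlus "('a, 'r) core" "('a, 'r) core"

primrec core_sem ::
  "'a list \<Rightarrow> (fovar \<Rightarrow> nat) \<Rightarrow> (sovar \<Rightarrow> nat set) \<Rightarrow> ('a, 'r) core \<Rightarrow> 'r list multiset" where
  "core_sem w \<sigma> \<tau> Zero = {#}"
| "core_sem w \<sigma> \<tau> (ProdFO x \<Psi>) =
     {# map (\<lambda>i. step_sem w (\<sigma>(x := i)) \<tau> \<Psi>) [1..<length w + 1] #}"
| "core_sem w \<sigma> \<tau> (CoreIf \<phi> \<Phi>1 \<Phi>2) =
     (if mso_sat w \<sigma> \<tau> \<phi> then core_sem w \<sigma> \<tau> \<Phi>1 else core_sem w \<sigma> \<tau> \<Phi>2)"
| "core_sem w \<sigma> \<tau> (CorePlus \<Phi>1 \<Phi>2) = core_sem w \<sigma> \<tau> \<Phi>1 + core_sem w \<sigma> \<tau> \<Phi>2"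

definition core_equiv :: "'a mso set \<Rightarrow> ('a, 'r) core \<Rightarrow> ('a, 'r) core \<Rightarrow> bool" where
  "core_equiv \<Gamma> \<Phi>1 \<Phi>2 \<longleftrightarrow>
     (\<forall>w \<sigma> \<tau>. models w \<sigma> \<tau> \<Gamma> \<longrightarrow> core_sem w \<sigma> \<tau> \<Phi>1 = core_sem w \<sigma> \<tau> \<Phi>2)"

inductive core_prov ::
  "('a mso set \<Rightarrow> 'a mso \<Rightarrow> bool) \<Rightarrow> 'a mso set \<Rightarrow> ('a, 'r) core \<Rightarrow> ('a, 'r) core \<Rightarrow> bool"
  for prov :: "'a mso set \<Rightarrow> 'a mso \<Rightarrow> bool" where
  C_ref: "core_prov prov \<Gamma> \<Phi> \<Phi>"
| C_sym: "core_prov prov \<Gamma> \<Phi>1 \<Phi>2 \<Longrightarrow> core_prov prov \<Gamma> \<Phi>2 \<Phi>1"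
| C_trans: "core_prov prov \<Gamma> \<Phi>1 \<Phi>2 \<Longrightarrow> core_prov prov \<Gamma> \<Phi>2 \<Phi>3 \<Longrightarrow> core_prov prov \<Gamma> \<Phi>1 \<Phi>3"
| C_cong_if: "core_prov prov \<Gamma> \<Phi>1 \<Phi>1' \<Longrightarrow> core_prov prov \<Gamma> \<Phi>2 \<Phi>2' \<Longrightarrow>
    core_prov prov \<Gamma> (CoreIf \<phi> \<Phi>1 \<Phi>2) (CoreIf \<phi> \<Phi>1' \<Phi>2')"
| C_cong_plus: "core_prov prov \<Gamma> \<Phi>1 \<Phi>1' \<Longrightarrow> core_prov prov \<Gamma> \<Phi>2 \<Phi>2' \<Longrightarrow>
    core_prov prov \<Gamma> (CorePlus \<Phi>1 \<Phi>2) (CorePlus \<Phi>1' \<Phi>2')"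
| C1: "core_prov prov \<Gamma> (CorePlus \<Phi> Zero) \<Phi>"
| C2: "core_prov prov \<Gamma> (CorePlus \<Phi>1 \<Phi>2) (CorePlus \<Phi>2 \<Phi>1)"
| C3: "core_prov prov \<Gamma> (CorePlus (CorePlus \<Phi>1 \<Phi>2) \<Phi>3) (CorePlus \<Phi>1 (CorePlus \<Phi>2 \<Phi>3))"
| C4: "step_prov prov \<Gamma> \<Psi>1 \<Psi>2 \<Longrightarrow> \<forall>\<phi>\<in>\<Gamma>. x \<notin> mso_free \<phi> \<Longrightarrow>
    core_prov prov \<Gamma> (ProdFO x \<Psi>1) (ProdFO x \<Psi>2)"
| C5: "y \<notin> step_vars \<Psi> \<Longrightarrow> core_prov prov \<Gamma> (ProdFO x \<Psi>) (ProdFO y (step_subst y x \<Psi>))"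
| C6: "core_prov prov \<Gamma> \<Phi>1 \<Phi>2 \<Longrightarrow> core_prov prov (\<Gamma> \<union> {\<phi>}) \<Phi>1 \<Phi>2"
| C7: "core_prov prov \<Gamma> (CoreIf (Neg \<phi>) \<Phi>1 \<Phi>2) (CoreIf \<phi> \<Phi>2 \<Phi>1)"
| C8: "prov \<Gamma> \<phi> \<Longrightarrow> core_prov prov \<Gamma> (CoreIf \<phi> \<Phi>1 \<Phi>2) \<Phi>1"
| C9: "core_prov prov (\<Gamma> \<union> {\<phi>}) \<Phi>1 \<Phi> \<Longrightarrow> core_prov prov (\<Gamma> \<union> {Neg \<phi>}) \<Phi>2 \<Phi> \<Longrightarrow>
    core_prov prov \<Gamma> (CoreIf \<phi> \<Phi>1 \<Phi>2) \<Phi>"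
| C10: "core_prov prov \<Gamma> (CorePlus (CoreIf \<phi> \<Phi>' \<Phi>'') \<Phi>)
    (CoreIf \<phi> (CorePlus \<Phi>' \<Phi>) (CorePlus \<Phi>'' \<Phi>))"

end

(* Completeness: the derived case split on an arbitrary formula lets us extend Gamma until every
   guard outside the products is decided, so that both formulas become finite sums of products.
   Which product of the left sum matches which product of the right one may still depend on the
   model, but equality of two products is expressible in MSO, so a further case split fixes the
   partner of the first product, and both are cancelled. Two equivalent products are provably
   equal by renaming their bound variables to a common one that is fresh for the current Gamma. *)
theory Submission imports Defs begin

section \<open>Free variables and substitution\<close>

lemma finite_mso_vars: "finite (mso_vars \<phi>)"
  by (induction \<phi>) auto

lemma mso_free_subset_vars: "mso_free \<phi> \<subseteq> mso_vars \<phi>"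
  by (induction \<phi>) auto

lemma finite_step_vars: "finite (step_vars \<Psi>)"
  by (induction \<Psi>) (auto simp: finite_mso_vars)

lemma mso_sat_fun_upd_not_free:
  "x \<notin> mso_free \<phi> \<Longrightarrow> mso_sat w (\<sigma>(x := i)) \<tau> \<phi> \<longleftrightarrow> mso_sat w \<sigma> \<tau> \<phi>"
proof (induction \<phi> arbitrary: \<sigma> \<tau>)
  case (AllFO y \<phi>)
  show ?case
  proof (cases "x = y")
    case False
    then have "mso_sat w (\<sigma>(x := i, y := j)) \<tau> \<phi> \<longleftrightarrow> mso_sat w (\<sigma>(y := j)) \<tau> \<phi>" for j
      using AllFO by (simp add: fun_upd_twist[OF False] del: fun_upd_apply)
    then show ?thesis
      by (simp del: fun_upd_apply)
  qed (simp del: fun_upd_apply)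
qed auto

lemma mso_sat_fun_upd_not_occurs:
  "x \<notin> mso_vars \<phi> \<Longrightarrow> mso_sat w (\<sigma>(x := i)) \<tau> \<phi> \<longleftrightarrow> mso_sat w \<sigma> \<tau> \<phi>"
  using mso_sat_fun_upd_not_free mso_free_subset_vars by blast

lemma step_sem_fun_upd_not_occurs:
  "x \<notin> step_vars \<Psi> \<Longrightarrow> step_sem w (\<sigma>(x := i)) \<tau> \<Psi> = step_sem w \<sigma> \<tau> \<Psi>"
  by (induction \<Psi>) (auto simp: mso_sat_fun_upd_not_occurs)

text \<open>Excluding \<open>y\<close> from the bound variables as well makes capture impossible:
  every quantified \<open>z\<close> differs from \<open>y\<close>, so updating \<open>z\<close>
  leaves \<sigma> y intact. At \<open>z = x\<close> the substitution stops, and the inner update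
  overrides the outer one.\<close>

lemma mso_sat_subst:
  "y \<notin> mso_vars \<phi> \<Longrightarrow> mso_sat w \<sigma> \<tau> (mso_subst y x \<phi>) \<longleftrightarrow> mso_sat w (\<sigma>(x := \<sigma> y)) \<tau> \<phi>"
proof (induction \<phi> arbitrary: \<sigma> \<tau>)
  case (AllFO z \<phi>)
  show ?case
  proof (cases "z = x")
    case False
    then have "mso_sat w (\<sigma>(z := i)) \<tau> (mso_subst y x \<phi>) \<longleftrightarrow>
        mso_sat w (\<sigma>(x := \<sigma> y, z := i)) \<tau> \<phi>" for i
      using AllFO by (simp add: fun_upd_twist[OF False] fun_upd_other del: fun_upd_apply)
    with False show ?thesis
      by (simp del: fun_upd_apply)
  qed (simp del: fun_upd_apply)
qed auto

lemma step_sem_subst: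
  "y \<notin> step_vars \<Psi> \<Longrightarrow> step_sem w \<sigma> \<tau> (step_subst y x \<Psi>) = step_sem w (\<sigma>(x := \<sigma> y)) \<tau> \<Psi>"
  by (induction \<Psi>) (auto simp: mso_sat_subst)

text \<open>Semantic counterpart of \<open>C5\<close>, also used to give two products a common bound
  variable. After substitution both \<open>y\<close> and \<open>x\<close> hold the position
  \<open>i\<close>; the value of \<open>y\<close> is then irrelevant by freshness.\<close>

lemma core_sem_rename:
  assumes "y \<notin> step_vars \<Psi>"
  shows "core_sem w \<sigma> \<tau> (ProdFO y (step_subst y x \<Psi>)) = core_sem w \<sigma> \<tau> (ProdFO x \<Psi>)"
proof (cases "x = y")
  case False
  then show ?thesis
    using assms by (auto simp: step_sem_subst step_sem_fun_upd_not_occurs fun_upd_twist[of y x])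
qed (use assms in \<open>auto simp: step_sem_subst\<close>)

section \<open>Contexts and their models\<close>

lemma models_insert: "models w \<sigma> \<tau> (insert \<phi> \<Gamma>) \<longleftrightarrow> models w \<sigma> \<tau> \<Gamma> \<and> mso_sat w \<sigma> \<tau> \<phi>"
  by (auto simp: models_def)

lemma models_mono: "models w \<sigma> \<tau> \<Delta> \<Longrightarrow> \<Gamma> \<subseteq> \<Delta> \<Longrightarrow> models w \<sigma> \<tau> \<Gamma>"
  by (auto simp: models_def)

lemma models_fun_upd:
  assumes "models w \<sigma> \<tau> \<Gamma>" "\<forall>\<phi>\<in>\<Gamma>. x \<notin> mso_free \<phi>" "i \<in> positions w"
  shows "models w (\<sigma>(x := i)) \<tau> \<Gamma>"
  using assms by (auto simp: models_def valuation_def mso_sat_fun_upd_not_free)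

definition step_equiv :: "'a mso set \<Rightarrow> ('a, 'r) step \<Rightarrow> ('a, 'r) step \<Rightarrow> bool" where
  "step_equiv \<Gamma> \<Psi>1 \<Psi>2 \<longleftrightarrow>
     (\<forall>w \<sigma> \<tau>. models w \<sigma> \<tau> \<Gamma> \<longrightarrow> step_sem w \<sigma> \<tau> \<Psi>1 = step_sem w \<sigma> \<tau> \<Psi>2)"

definition unsat :: "'a mso set \<Rightarrow> bool" where
  "unsat \<Gamma> \<longleftrightarrow> (\<forall>w \<sigma> \<tau>. \<not> models w \<sigma> \<tau> \<Gamma>)"

lemma core_equiv_mono: "core_equiv \<Gamma> \<Phi>1 \<Phi>2 \<Longrightarrow> \<Gamma> \<subseteq> \<Delta> \<Longrightarrow> core_equiv \<Delta> \<Phi>1 \<Phi>2"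
  by (auto simp: core_equiv_def dest: models_mono)


section \<open>Sums of products and definable equality\<close>

text \<open>The normal form: no conditionals outside the products. Each summand keeps its own bound
  variable; renaming happens only when two products are compared.\<close>

definition sum_prods :: "(fovar \<times> ('a, 'r) step) list \<Rightarrow> ('a, 'r) core" where
  "sum_prods ps = foldr (\<lambda>(x, \<Psi>). CorePlus (ProdFO x \<Psi>)) ps Zero"

lemma sum_prods_simps [simp]:
  "sum_prods [] = Zero"
  "sum_prods ((x, \<Psi>) # ps) = CorePlus (ProdFO x \<Psi>) (sum_prods ps)"
  by (simp_all add: sum_prods_def)

lemma mem_core_sem_sum_prods:
  "v \<in># core_sem w \<sigma> \<tau> (sum_prods ps) \<Longrightarrow>
   \<exists>(x, \<Psi>)\<in>set ps. core_sem w \<sigma> \<tau> (ProdFO x \<Psi>) = {#v#}"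
  by (induction ps) auto

text \<open>Step formulas are finite decision trees over MSO guards, so comparing two of them
  unfolds one tree after the other into a combination of guards.\<close>

lemma step_eq_definable:
  fixes \<Psi>1 \<Psi>2 :: "('a, 'r) step"
  shows "\<exists>\<phi>. \<forall>w \<sigma> \<tau>. mso_sat w \<sigma> \<tau> \<phi> \<longleftrightarrow> step_sem w \<sigma> \<tau> \<Psi>1 = step_sem w \<sigma> \<tau> \<Psi>2"
proof -
  have cond: "\<exists>\<phi>. \<forall>w \<sigma> \<tau>. mso_sat w \<sigma> \<tau> \<phi> \<longleftrightarrow>
      (if mso_sat w \<sigma> \<tau> \<gamma> then mso_sat w \<sigma> \<tau> \<alpha> else mso_sat w \<sigma> \<tau> \<beta>)" for \<alpha> \<beta> \<gamma> :: "'a mso"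
    \<comment> \<open>The conditional as (\<gamma> implies \<alpha>) and (not \<gamma> implies
      \<beta>), spelled with \<open>Neg\<close> and \<open>Conj\<close>.\<close>
    by (rule exI[of _ "Conj (Neg (Conj \<gamma> (Neg \<alpha>))) (Neg (Conj (Neg \<gamma>) (Neg \<beta>)))"]) auto
  have weight: "\<exists>\<phi>. \<forall>w \<sigma> \<tau>. mso_sat w \<sigma> \<tau> \<phi> \<longleftrightarrow> step_sem w \<sigma> \<tau> \<Psi> = r"
    for \<Psi> :: "('a, 'r) step" and r
  proof (induction \<Psi>)
    case (Weight s)
    show ?case
      \<comment> \<open>Whether two weights coincide does not depend on the model, so it is decided
        outside the formula.\<close>
      by (rule exI[of _ "if s = r then Top else Neg Top"]) auto
  next
    case (StepIf \<gamma> \<Psi> \<Psi>')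
    then obtain \<alpha> \<beta> where
      "\<forall>w \<sigma> \<tau>. mso_sat w \<sigma> \<tau> \<alpha> \<longleftrightarrow> step_sem w \<sigma> \<tau> \<Psi> = r"
      "\<forall>w \<sigma> \<tau>. mso_sat w \<sigma> \<tau> \<beta> \<longleftrightarrow> step_sem w \<sigma> \<tau> \<Psi>' = r"
      by blast
    with cond[of \<gamma> \<alpha> \<beta>] show ?case
      by (simp add: if_distrib[of "\<lambda>s. s = _"] cong: if_cong)
  qed
  show ?thesis
  proof (induction \<Psi>1)
    case (Weight r)
    from weight[of \<Psi>2 r] show ?case
      by (simp add: eq_commute[of r])
  next
    case (StepIf \<gamma> \<Psi> \<Psi>')
    then obtain \<alpha> \<beta> where
      "\<forall>w \<sigma> \<tau>. mso_sat w \<sigma> \<tau> \<alpha> \<longleftrightarrow> step_sem w \<sigma> \<tau> \<Psi> = step_sem w \<sigma> \<tau> \<Psi>2"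
      "\<forall>w \<sigma> \<tau>. mso_sat w \<sigma> \<tau> \<beta> \<longleftrightarrow> step_sem w \<sigma> \<tau> \<Psi>' = step_sem w \<sigma> \<tau> \<Psi>2"
      by blast
    with cond[of \<gamma> \<alpha> \<beta>] show ?case
      by (simp add: if_distrib[of "\<lambda>s. s = _"] cong: if_cong)
  qed
qed

text \<open>Both words have length \<open>length w\<close>, so they are equal iff they agree at
  every position. Over a common fresh variable \<open>z\<close> this is a first-order quantifier in
  front of an equality of steps.\<close>

lemma prod_eq_definable:
  "\<exists>\<phi>. \<forall>w \<sigma> \<tau>. mso_sat w \<sigma> \<tau> \<phi> \<longleftrightarrow>
     core_sem w \<sigma> \<tau> (ProdFO x \<Psi>1) = core_sem w \<sigma> \<tau> (ProdFO y \<Psi>2)"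
proof -
  obtain z where z: "z \<notin> step_vars \<Psi>1 \<union> step_vars \<Psi>2"
    using ex_new_if_finite[OF infinite_UNIV_nat] finite_step_vars by (metis finite_UnI)
  obtain \<phi> where "\<forall>w \<sigma> \<tau>. mso_sat w \<sigma> \<tau> \<phi> \<longleftrightarrow>
      step_sem w \<sigma> \<tau> (step_subst z x \<Psi>1) = step_sem w \<sigma> \<tau> (step_subst z y \<Psi>2)"
    using step_eq_definable by metis
  then have "mso_sat w \<sigma> \<tau> (AllFO z \<phi>) \<longleftrightarrow> core_sem w \<sigma> \<tau> (ProdFO z (step_subst z x \<Psi>1))
      = core_sem w \<sigma> \<tau> (ProdFO z (step_subst z y \<Psi>2))" for w \<sigma> \<tau>
    by (auto simp: positions_def)
  then show ?thesis
    using z by (metis Un_iff core_sem_rename)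
qed


section \<open>Soundness\<close>

text \<open>Derivability in MSO stays abstract. Both assumptions concern finite contexts, hence
  every extension of a context below is kept finite.\<close>

locale mso_proof_system =
  fixes prov :: "'a mso set \<Rightarrow> 'a mso \<Rightarrow> bool"
  assumes sound: "finite \<Delta> \<Longrightarrow> prov \<Delta> \<phi> \<Longrightarrow> mso_entails \<Delta> \<phi>"
    and complete: "finite \<Delta> \<Longrightarrow> mso_entails \<Delta> \<phi> \<Longrightarrow> prov \<Delta> \<phi>"
begin

lemma step_prov_sound:
  "step_prov prov \<Gamma> \<Psi>1 \<Psi>2 \<Longrightarrow> finite \<Gamma> \<Longrightarrow> step_equiv \<Gamma> \<Psi>1 \<Psi>2"
proof (induction rule: step_prov.induct)
  case (S3 \<Gamma> \<phi> \<Psi>1 \<Psi>2)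
  then show ?case
    using sound by (fastforce simp: step_equiv_def mso_entails_def)
qed (auto simp: step_equiv_def models_insert)

lemma core_prov_sound:
  "core_prov prov \<Gamma> \<Phi>1 \<Phi>2 \<Longrightarrow> finite \<Gamma> \<Longrightarrow> core_equiv \<Gamma> \<Phi>1 \<Phi>2"
proof (induction rule: core_prov.induct)
  case (C4 \<Gamma> \<Psi>1 \<Psi>2 x)
  then have "step_equiv \<Gamma> \<Psi>1 \<Psi>2"
    by (simp add: step_prov_sound)
  \<comment> \<open>The letters of a product are evaluated at shifted valuations; these still
    satisfy \<Gamma>, since \<open>x\<close> is not free in it and \<open>i\<close> is a
    position.\<close>
  then have "step_sem w (\<sigma>(x := i)) \<tau> \<Psi>1 = step_sem w (\<sigma>(x := i)) \<tau> \<Psi>2"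
    if "models w \<sigma> \<tau> \<Gamma>" "i \<in> positions w" for w \<sigma> \<tau> i
    using models_fun_upd[OF that(1) C4(2) that(2)] by (simp add: step_equiv_def)
  then show ?case
    by (fastforce simp: core_equiv_def positions_def)
next
  case (C5 y \<Psi> \<Gamma> x)
  then show ?case
    by (simp add: core_equiv_def core_sem_rename del: core_sem.simps)
next
  case (C8 \<Gamma> \<phi> \<Phi>1 \<Phi>2)
  then show ?case
    using sound by (fastforce simp: core_equiv_def mso_entails_def)
qed (auto simp: core_equiv_def models_insert ac_simps)


section \<open>Completeness for step formulas\<close>

lemma prov_if_unsat: "finite \<Gamma> \<Longrightarrow> unsat \<Gamma> \<Longrightarrow> prov \<Gamma> \<phi>"
  by (auto simp: unsat_def mso_entails_def intro!: complete)

text \<open>An unsatisfiable context proves both \<phi> and \<open>Neg \<phi>\<close>, so one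
  conditional collapses to either branch: by \<open>S3\<close> directly, and by \<open>S2\<close>
  followed by \<open>S3\<close>.\<close>

lemma step_prov_if_unsat:
  assumes "finite \<Gamma>" "unsat \<Gamma>"
  shows "step_prov prov \<Gamma> \<Psi>1 \<Psi>2"
  using prov_if_unsat[OF assms] by (meson S2 S3 S_sym S_trans)

text \<open>\<open>S4\<close> breaks up the left tree while the right side stays fixed. With a
  constant on the right, only comparisons of two weights remain at the leaves.\<close>

lemma step_complete_Weight:
  "finite \<Gamma> \<Longrightarrow> step_equiv \<Gamma> \<Psi> (Weight r) \<Longrightarrow> step_prov prov \<Gamma> \<Psi> (Weight r)"
proof (induction \<Psi> arbitrary: \<Gamma>)
  case (Weight s)
  \<comment> \<open>Distinct weights can be equivalent only in a context without models.\<close>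
  then show ?case
    by (cases "r = s") (auto simp: step_equiv_def unsat_def intro: S_ref step_prov_if_unsat)
next
  case (StepIf \<phi> \<Psi>1 \<Psi>2)
  show ?case
    using StepIf.prems
    by (intro S4 StepIf.IH) (fastforce simp: step_equiv_def models_insert split: if_splits)+
qed

lemma step_complete:
  "finite \<Gamma> \<Longrightarrow> step_equiv \<Gamma> \<Psi>1 \<Psi>2 \<Longrightarrow> step_prov prov \<Gamma> \<Psi>1 \<Psi>2"
proof (induction \<Psi>1 arbitrary: \<Gamma>)
  case (Weight r)
  then show ?case
    by (auto simp: step_equiv_def intro!: S_sym[OF step_complete_Weight])
next
  case (StepIf \<phi> \<Psi>1 \<Psi>1')
  show ?case
    using StepIf.prems
    by (intro S4 StepIf.IH) (fastforce simp: step_equiv_def models_insert split: if_splits)+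
qed


section \<open>Completeness for sums of products\<close>

lemma core_prov_mono:
  assumes "core_prov prov \<Gamma> \<Phi>1 \<Phi>2" "\<Gamma> \<subseteq> \<Delta>" "finite \<Delta>"
  shows "core_prov prov \<Delta> \<Phi>1 \<Phi>2"
proof -
  \<comment> \<open>\<open>C6\<close> adds a single formula, so weakening reaches finite extensions
    by induction; \<open>F\<close> is later taken to be \<Delta> itself.\<close>
  have "core_prov prov (\<Gamma> \<union> F) \<Phi>1 \<Phi>2" if "finite F" for F
    using that
  proof (induction F)
    case (insert \<phi> F)
    then show ?case
      using C6[of prov "\<Gamma> \<union> F" \<Phi>1 \<Phi>2 \<phi>] by simp
  qed (use assms in simp)
  then show ?thesis
    using assms by (metis sup.absorb2)
qed

lemma core_prov_if_unsat:
  assumes "finite \<Gamma>" "unsat \<Gamma>"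
  shows "core_prov prov \<Gamma> \<Phi>1 \<Phi>2"
  using prov_if_unsat[OF assms] by (meson C7 C8 C_sym C_trans)

text \<open>Insert the conditional with two equal branches: by \<open>C9\<close> it equals \<Phi>1
  through reflexivity, and \<Phi>2 through the two assumptions.\<close>

lemma core_prov_split:
  assumes "core_prov prov (\<Gamma> \<union> {\<phi>}) \<Phi>1 \<Phi>2" "core_prov prov (\<Gamma> \<union> {Neg \<phi>}) \<Phi>1 \<Phi>2"
  shows "core_prov prov \<Gamma> \<Phi>1 \<Phi>2"
  by (meson C9[OF C_ref C_ref] C9[OF assms] C_sym C_trans)

lemma core_prov_CoreIf_pos:
  "finite \<Gamma> \<Longrightarrow> \<phi> \<in> \<Gamma> \<Longrightarrow> core_prov prov \<Gamma> (CoreIf \<phi> \<Phi>1 \<Phi>2) \<Phi>1"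
  by (auto simp: mso_entails_def models_def intro!: C8 complete)

lemma core_prov_CoreIf_neg:
  "finite \<Gamma> \<Longrightarrow> Neg \<phi> \<in> \<Gamma> \<Longrightarrow> core_prov prov \<Gamma> (CoreIf \<phi> \<Phi>1 \<Phi>2) \<Phi>2"
  by (meson C7 C_sym C_trans core_prov_CoreIf_pos)

lemma prod_complete:
  assumes fin: "finite \<Gamma>" and eq: "core_equiv \<Gamma> (ProdFO x \<Psi>1) (ProdFO y \<Psi>2)"
  shows "core_prov prov \<Gamma> (ProdFO x \<Psi>1) (ProdFO y \<Psi>2)"
proof -
  have "finite (\<Union>(mso_vars ` \<Gamma>) \<union> step_vars \<Psi>1 \<union> step_vars \<Psi>2)"
    using fin by (auto simp: finite_mso_vars finite_step_vars)
  \<comment> \<open>Avoiding \<Gamma> serves the side condition of \<open>C4\<close>, avoiding both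
    bodies that of \<open>C5\<close>.\<close>
  then obtain z where z: "z \<notin> \<Union>(mso_vars ` \<Gamma>) \<union> step_vars \<Psi>1 \<union> step_vars \<Psi>2"
    using ex_new_if_finite[OF infinite_UNIV_nat] by metis
  let ?\<Psi>1 = "step_subst z x \<Psi>1" and ?\<Psi>2 = "step_subst z y \<Psi>2"
  have "step_equiv \<Gamma> ?\<Psi>1 ?\<Psi>2"
    unfolding step_equiv_def
  proof (intro allI impI)
    fix w \<sigma> \<tau>
    assume m: "models w \<sigma> \<tau> \<Gamma>"
    then have "core_sem w \<sigma> \<tau> (ProdFO z ?\<Psi>1) = core_sem w \<sigma> \<tau> (ProdFO z ?\<Psi>2)"
      using eq z by (simp add: core_sem_rename core_equiv_def del: core_sem.simps)
    \<comment> \<open>In the step formulas \<open>z\<close> is free and denotes the position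
      \<sigma> z, so the goal is the equality of the letters at that position of two equal
      words.\<close>
    moreover have "\<sigma> z \<in> {1..<length w + 1}"
      using m by (auto simp: models_def valuation_def positions_def less_Suc_eq_le Suc_le_eq)
    ultimately have "step_sem w (\<sigma>(z := \<sigma> z)) \<tau> ?\<Psi>1 = step_sem w (\<sigma>(z := \<sigma> z)) \<tau> ?\<Psi>2"
      by (simp only: core_sem.simps single_eq_single map_eq_conv set_upt)
    then show "step_sem w \<sigma> \<tau> ?\<Psi>1 = step_sem w \<sigma> \<tau> ?\<Psi>2"
      by simp
  qed
  then have "core_prov prov \<Gamma> (ProdFO z ?\<Psi>1) (ProdFO z ?\<Psi>2)"
    using z mso_free_subset_vars by (blast intro: C4 step_complete[OF fin])
  moreover have "core_prov prov \<Gamma> (ProdFO x \<Psi>1) (ProdFO z ?\<Psi>1)"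
    "core_prov prov \<Gamma> (ProdFO y \<Psi>2) (ProdFO z ?\<Psi>2)"
    using z by (auto intro: C5)
  ultimately show ?thesis
    by (meson C_sym C_trans)
qed

section \<open>Rearranging sums and matching their summands\<close>

lemma core_prov_sum_prods_append:
  "core_prov prov \<Gamma> (CorePlus (sum_prods ps) (sum_prods qs)) (sum_prods (ps @ qs))"
proof (induction ps)
  case Nil
  show ?case
    by (auto intro: C_trans[OF C2 C1])
next
  case (Cons p ps)
  then show ?case
    by (cases p) (auto intro: C_trans[OF C3] C_cong_plus C_ref)
qed

lemma core_prov_sum_prods_remove1:
  "(x, \<Psi>) \<in> set qs \<Longrightarrow>
   core_prov prov \<Gamma> (sum_prods qs) (CorePlus (ProdFO x \<Psi>) (sum_prods (remove1 (x, \<Psi>) qs)))"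
proof (induction qs)
  case (Cons q qs)
  obtain y \<Psi>' where q: "q = (y, \<Psi>')"
    by force
  show ?case
  proof (cases "q = (x, \<Psi>)")
    case False
    let ?P = "ProdFO x \<Psi>" and ?Q = "ProdFO y \<Psi>'" and ?R = "sum_prods (remove1 (x, \<Psi>) qs)"
    have "core_prov prov \<Gamma> (sum_prods (q # qs)) (CorePlus ?Q (CorePlus ?P ?R))"
      using Cons False by (auto simp: q intro: C_cong_plus C_ref)
    moreover have "core_prov prov \<Gamma> (CorePlus ?Q (CorePlus ?P ?R)) (CorePlus ?P (CorePlus ?Q ?R))"
      by (meson C2 C3 C_cong_plus C_ref C_sym C_trans)
    ultimately show ?thesis
      using False by (auto simp: q intro: C_trans)
  qed (auto intro: C_ref)
qed simp

text \<open>Iterated case split: either some \<open>E q\<close> is assumed or all of them are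
  negated. The premises range over all finite extensions because the context grows along the
  list.\<close>

lemma core_prov_split_list:
  assumes "finite \<Gamma>"
    and "\<And>q \<Delta>. q \<in> set qs \<Longrightarrow> finite \<Delta> \<Longrightarrow> \<Gamma> \<subseteq> \<Delta> \<Longrightarrow> E q \<in> \<Delta> \<Longrightarrow> core_prov prov \<Delta> \<Phi>1 \<Phi>2"
    and "\<And>\<Delta>. finite \<Delta> \<Longrightarrow> \<Gamma> \<subseteq> \<Delta> \<Longrightarrow> \<forall>q\<in>set qs. Neg (E q) \<in> \<Delta> \<Longrightarrow> core_prov prov \<Delta> \<Phi>1 \<Phi>2"
  shows "core_prov prov \<Gamma> \<Phi>1 \<Phi>2"
  using assms
proof (induction qs arbitrary: \<Gamma>)
  case (Cons q qs)
  show ?case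
  proof (rule core_prov_split[of _ "E q"])
    show "core_prov prov (\<Gamma> \<union> {E q}) \<Phi>1 \<Phi>2"
      using Cons.prems(1) by (intro Cons.prems(2)[of q]) auto
    show "core_prov prov (\<Gamma> \<union> {Neg (E q)}) \<Phi>1 \<Phi>2"
    proof (rule Cons.IH)
      show "core_prov prov \<Delta> \<Phi>1 \<Phi>2"
        if "p \<in> set qs" "finite \<Delta>" "\<Gamma> \<union> {Neg (E q)} \<subseteq> \<Delta>" "E p \<in> \<Delta>" for p \<Delta>
        using that by (intro Cons.prems(2)[of p]) auto
      show "core_prov prov \<Delta> \<Phi>1 \<Phi>2"
        if "finite \<Delta>" "\<Gamma> \<union> {Neg (E q)} \<subseteq> \<Delta>" "\<forall>p\<in>set qs. Neg (E p) \<in> \<Delta>" for \<Delta>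
        using that by (intro Cons.prems(3)) auto
    qed (use Cons.prems(1) in simp)
  qed
qed simp

lemma sum_prods_complete:
  fixes ps qs :: "(fovar \<times> ('a, 'r) step) list"
  assumes "finite \<Gamma>" "core_equiv \<Gamma> (sum_prods ps) (sum_prods qs)"
  shows "core_prov prov \<Gamma> (sum_prods ps) (sum_prods qs)"
  using assms
proof (induction ps arbitrary: \<Gamma> qs)
  case Nil
  show ?case
  proof (cases qs)
    case (Cons q qs')
    \<comment> \<open>A nonempty right sum contains a word and the empty left sum none.\<close>
    then have "unsat \<Gamma>"
      using Nil by (cases q) (auto simp: core_equiv_def unsat_def)
    then show ?thesis
      using Nil core_prov_if_unsat by blast
  qed (simp add: C_ref)
next
  case (Cons p ps)
  obtain x \<Psi> where p: "p = (x, \<Psi>)"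
    by force
  have "\<forall>q. \<exists>\<phi>. \<forall>w \<sigma> \<tau>. mso_sat w \<sigma> \<tau> \<phi> \<longleftrightarrow>
      core_sem w \<sigma> \<tau> (ProdFO x \<Psi>) = core_sem w \<sigma> \<tau> (ProdFO (fst q) (snd q :: ('a, 'r) step))"
    using prod_eq_definable by blast
  then obtain E where E: "\<And>q w \<sigma> \<tau>. mso_sat w \<sigma> \<tau> (E q) \<longleftrightarrow>
      core_sem w \<sigma> \<tau> (ProdFO x \<Psi>) = core_sem w \<sigma> \<tau> (ProdFO (fst q) (snd q :: ('a, 'r) step))"
    by metis
  show ?case
  proof (rule core_prov_split_list[of _ qs E])
    fix q \<Delta>
    assume q: "q \<in> set qs" and \<Delta>: "finite \<Delta>" "\<Gamma> \<subseteq> \<Delta>" "E q \<in> \<Delta>"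
    let ?Q = "ProdFO (fst q) (snd q)" and ?qs = "sum_prods (remove1 q qs)"
    have qs: "core_prov prov \<Delta> (sum_prods qs) (CorePlus ?Q ?qs)"
      using core_prov_sum_prods_remove1[of "fst q" "snd q" qs] q by simp
    have head: "core_equiv \<Delta> (ProdFO x \<Psi>) ?Q"
      using \<Delta>(3) E[of _ _ _ q]
      by (auto simp: core_equiv_def models_def simp del: core_sem.simps)
    \<comment> \<open>Soundness turns the derived rearrangement of \<open>qs\<close> into equality
      of the multisets.\<close>
    have "core_equiv \<Delta> (sum_prods (p # ps)) (CorePlus ?Q ?qs)"
      using core_equiv_mono[OF Cons.prems(2) \<Delta>(2)] core_prov_sound[OF qs \<Delta>(1)]
      by (simp add: core_equiv_def)
    \<comment> \<open>The heads contribute the same singleton, which cancels in the multiset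
      sums.\<close>
    with head have "core_equiv \<Delta> (sum_prods ps) ?qs"
      by (simp add: core_equiv_def p del: core_sem.simps(2))
    then have "core_prov prov \<Delta> (sum_prods (p # ps)) (CorePlus ?Q ?qs)"
      using prod_complete[OF \<Delta>(1) head] Cons.IH[OF \<Delta>(1)] by (auto simp: p intro: C_cong_plus)
    with qs show "core_prov prov \<Delta> (sum_prods (p # ps)) (sum_prods qs)"
      by (meson C_sym C_trans)
  next
    fix \<Delta>
    assume \<Delta>: "finite \<Delta>" "\<Gamma> \<subseteq> \<Delta>" "\<forall>q\<in>set qs. Neg (E q) \<in> \<Delta>"
    \<comment> \<open>The word of the first product must come from some summand in
      \<open>qs\<close>, contradicting its negated \<open>E q\<close>; such a context has no
      model.\<close>
    have False if m: "models w \<sigma> \<tau> \<Delta>" for w \<sigma> \<tau>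
    proof -
      obtain v where v: "core_sem w \<sigma> \<tau> (ProdFO x \<Psi>) = {#v#}"
        by simp
      have sem_eq: "core_sem w \<sigma> \<tau> (sum_prods (p # ps)) = core_sem w \<sigma> \<tau> (sum_prods qs)"
        using core_equiv_mono[OF Cons.prems(2) \<Delta>(2)] m by (simp add: core_equiv_def)
      then have "v \<in># core_sem w \<sigma> \<tau> (sum_prods qs)"
        using v by (simp add: p del: core_sem.simps(2) flip: sem_eq)
      then obtain q where "q \<in> set qs" "core_sem w \<sigma> \<tau> (ProdFO (fst q) (snd q)) = {#v#}"
        using mem_core_sem_sum_prods by fastforce
      then show False
        using m \<Delta>(3) v E[of w \<sigma> \<tau> q] by (force simp: models_def simp del: core_sem.simps)
    qed
    then show "core_prov prov \<Delta> (sum_prods (p # ps)) (sum_prods qs)"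
      using \<Delta>(1) by (auto simp: unsat_def intro!: core_prov_if_unsat)
  qed (rule Cons.prems)
qed


section \<open>Reduction to sums of products\<close>

text \<open>The summands depend on how the guards are decided, so one \<open>ps\<close> need not
  serve all of \<Gamma>. Hence the form of a proof rule: an arbitrary goal \<Phi>1, \<Phi>2 may be
  proved in extensions where \<Phi> has a normal form.\<close>

lemma core_prov_normalize:
  assumes "finite \<Gamma>"
    and "\<And>\<Delta> ps. finite \<Delta> \<Longrightarrow> \<Gamma> \<subseteq> \<Delta> \<Longrightarrow> core_prov prov \<Delta> \<Phi> (sum_prods ps) \<Longrightarrow>
      core_prov prov \<Delta> \<Phi>1 \<Phi>2"
  shows "core_prov prov \<Gamma> \<Phi>1 \<Phi>2"
  using assms
proof (induction \<Phi> arbitrary: \<Gamma>)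
  case Zero
  then show ?case
    using C_ref by (metis order_refl sum_prods_simps(1))
next
  case (ProdFO x \<Psi>)
  have "core_prov prov \<Gamma> (ProdFO x \<Psi>) (sum_prods [(x, \<Psi>)])"
    by (simp add: C_sym[OF C1])
  then show ?case
    using ProdFO by blast
next
  case (CoreIf \<phi> \<Phi>' \<Phi>'')
  show ?case
  proof (rule core_prov_split[of _ \<phi>])
    show "core_prov prov (\<Gamma> \<union> {\<phi>}) \<Phi>1 \<Phi>2"
      by (rule CoreIf.IH(1))
        (auto simp: CoreIf.prems(1) intro!: CoreIf.prems(2) intro: C_trans core_prov_CoreIf_pos)
    show "core_prov prov (\<Gamma> \<union> {Neg \<phi>}) \<Phi>1 \<Phi>2"
      by (rule CoreIf.IH(2))
        (auto simp: CoreIf.prems(1) intro!: CoreIf.prems(2) intro: C_trans core_prov_CoreIf_neg)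
  qed
next
  case (CorePlus \<Phi>' \<Phi>'')
  show ?case
  \<comment> \<open>The second summand is normalized inside the context already extended for the
    first, whose derivation is then weakened to the final context.\<close>
  proof (rule CorePlus.IH(1)[OF CorePlus.prems(1)])
    fix \<Delta> ps
    assume \<Delta>: "finite \<Delta>" "\<Gamma> \<subseteq> \<Delta>" and ps: "core_prov prov \<Delta> \<Phi>' (sum_prods ps)"
    show "core_prov prov \<Delta> \<Phi>1 \<Phi>2"
    proof (rule CorePlus.IH(2)[OF \<Delta>(1)])
      fix \<Delta>' qs
      assume \<Delta>': "finite \<Delta>'" "\<Delta> \<subseteq> \<Delta>'" and qs: "core_prov prov \<Delta>' \<Phi>'' (sum_prods qs)"
      have "core_prov prov \<Delta>' (CorePlus \<Phi>' \<Phi>'') (sum_prods (ps @ qs))"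
        using core_prov_mono[OF ps \<Delta>'(2,1)] qs core_prov_sum_prods_append
        by (meson C_cong_plus C_trans)
      then show "core_prov prov \<Delta>' \<Phi>1 \<Phi>2"
        using CorePlus.prems(2) \<Delta> \<Delta>' by blast
    qed
  qed
qed

lemma core_complete:
  assumes "finite \<Gamma>" "core_equiv \<Gamma> \<Phi>1 \<Phi>2"
  shows "core_prov prov \<Gamma> \<Phi>1 \<Phi>2"
proof (rule core_prov_normalize[OF assms(1)])
  fix \<Delta> ps
  assume \<Delta>: "finite \<Delta>" "\<Gamma> \<subseteq> \<Delta>" and ps: "core_prov prov \<Delta> \<Phi>1 (sum_prods ps)"
  show "core_prov prov \<Delta> \<Phi>1 \<Phi>2"
  proof (rule core_prov_normalize[OF \<Delta>(1)])
    fix \<Delta>' qs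
    assume \<Delta>': "finite \<Delta>'" "\<Delta> \<subseteq> \<Delta>'" and qs: "core_prov prov \<Delta>' \<Phi>2 (sum_prods qs)"
    have ps': "core_prov prov \<Delta>' \<Phi>1 (sum_prods ps)"
      using core_prov_mono[OF ps \<Delta>'(2,1)] .
    have "core_equiv \<Delta>' \<Phi>1 \<Phi>2"
      using core_equiv_mono[OF assms(2)] \<Delta>(2) \<Delta>'(2) by blast
    \<comment> \<open>By soundness, the normal forms inherit the equivalence of \<Phi>1 and
      \<Phi>2.\<close>
    then have "core_equiv \<Delta>' (sum_prods ps) (sum_prods qs)"
      using core_prov_sound[OF ps' \<Delta>'(1)] core_prov_sound[OF qs \<Delta>'(1)]
      by (simp add: core_equiv_def)
    then have "core_prov prov \<Delta>' (sum_prods ps) (sum_prods qs)"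
      using sum_prods_complete[OF \<Delta>'(1)] by blast
    with ps' qs show "core_prov prov \<Delta>' \<Phi>1 \<Phi>2"
      by (meson C_sym C_trans)
  qed
qed

end

theorem theorem4:
  fixes mso_prov :: "'a::finite mso set \<Rightarrow> 'a mso \<Rightarrow> bool"
    and \<Gamma> :: "'a mso set"
    and \<Phi>1 \<Phi>2 :: "('a, 'r) core"
  assumes mso_sound: "\<And>\<Delta> \<phi>. finite \<Delta> \<Longrightarrow> mso_prov \<Delta> \<phi> \<Longrightarrow> mso_entails \<Delta> \<phi>"
    and mso_complete: "\<And>\<Delta> \<phi>. finite \<Delta> \<Longrightarrow> mso_entails \<Delta> \<phi> \<Longrightarrow> mso_prov \<Delta> \<phi>"
    and "finite \<Gamma>"
  shows "core_equiv \<Gamma> \<Phi>1 \<Phi>2 \<longleftrightarrow> core_prov mso_prov \<Gamma> \<Phi>1 \<Phi>2"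
proof -
  interpret mso_proof_system mso_prov
    using mso_sound mso_complete by unfold_locales
  show ?thesis
    using core_complete core_prov_sound \<open>finite \<Gamma>\<close> by blast
qed

end
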